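(* Let $r\ge 2$ and $k\ge1$. Let $T$ be a full ordered $r$-ary tree with $N(T)$ internal vertices, and let $s\in\{0,\ldots,k-1\}$ be the residue of $N(T)$ modulo $k$. Then $k\mid\lambda_T(i)$ for every leaf $i$ of $T$ if and only if $T$ can be obtained from $V^R_{r,s}$ by repeatedly (zero or more times) replacing a leaf with $V^R_{r,k}$. If every $\lambda_T(i)$ is $0$, then $T=V^R_{r,N(T)}$. The reflected statements also hold: $k\mid\rho_T(i)$ for every leaf $i$ of $T$ if and only if $T$ can be obtained from $V^L_{r,s}$ by repeatedly (zero or more times) replacing a leaf with $V^L_{r,k}$; and if every $\rho_T(i)$ is $0$, then $T=V^L_{r,N(T)}$.
   Context: A full ordered $r$-ary tree is either a single leaf or a root with an ordered $r$-tuple of full ordered $r$-ary subtrees. For a leaf $i$ of $T$, follow the path from the root to $i$. At each internal vertex on the path, the path enters one child; the subtrees rooted at the other children are left or right sibling subtrees. $\rho_T(i)$ (resp. $\lambda_T(i)$) is the total number of internal vertices in all right (resp. left) sibling subtrees encountered along the path. For $s\ge0$, the right $r$-ary vine $V^R_{r,s}$ of length $s$ has $s$ internal vertices in one chain starting at the root: except at the bottom of the chain, the rightmost child of each internal vertex is the next internal vertex, and every child not on the chain is a leaf. $V^R_{r,0}$ is a single leaf. $V^L_{r,s}$ is the mirror image, with the chain running through leftmost children. *)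

theory Defs
  imports Main
begin

datatype otree = Leaf | Node "otree list"

inductive full_tree :: "nat \<Rightarrow> otree \<Rightarrow> bool" for r :: nat where
  full_Leaf: "full_tree r Leaf"
| full_Node: "length ts = r \<Longrightarrow> (\<And>t. t \<in> set ts \<Longrightarrow> full_tree r t) \<Longrightarrow> full_tree r (Node ts)"

fun num_internal :: "otree \<Rightarrow> nat" where
  "num_internal Leaf = 0"
| "num_internal (Node ts) = Suc (\<Sum>t\<leftarrow>ts. num_internal t)"

text \<open>A leaf is identified with the path from the root to it: the list of the (0-based) indices
  of the children entered along the way.\<close>

inductive is_leaf :: "otree \<Rightarrow> nat list \<Rightarrow> bool" where
  leaf_here: "is_leaf Leaf []"
| leaf_below: "j < length ts \<Longrightarrow> is_leaf (ts ! j) p \<Longrightarrow> is_leaf (Node ts) (j # p)"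

text \<open>The next three functions are only meaningful on paths that stay inside the tree;
  the equations for a leaf with a nonempty path are junk values.\<close>

fun left_weight :: "otree \<Rightarrow> nat list \<Rightarrow> nat" where
  "left_weight t [] = 0"
| "left_weight Leaf (j # p) = 0"
| "left_weight (Node ts) (j # p) =
     (\<Sum>t\<leftarrow>take j ts. num_internal t) + left_weight (ts ! j) p"

fun right_weight :: "otree \<Rightarrow> nat list \<Rightarrow> nat" where
  "right_weight t [] = 0"
| "right_weight Leaf (j # p) = 0"
| "right_weight (Node ts) (j # p) =
     (\<Sum>t\<leftarrow>drop (Suc j) ts. num_internal t) + right_weight (ts ! j) p"

fun replace_at :: "otree \<Rightarrow> nat list \<Rightarrow> otree \<Rightarrow> otree" where
  "replace_at t [] u = u"
| "replace_at Leaf (j # p) u = Leaf"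
| "replace_at (Node ts) (j # p) u = Node (ts[j := replace_at (ts ! j) p u])"

definition expand_leaf :: "otree \<Rightarrow> otree \<Rightarrow> otree \<Rightarrow> bool" where
  "expand_leaf u t t' \<longleftrightarrow> (\<exists>p. is_leaf t p \<and> t' = replace_at t p u)"

fun right_vine :: "nat \<Rightarrow> nat \<Rightarrow> otree" where
  "right_vine r 0 = Leaf"
| "right_vine r (Suc s) = Node (replicate (r - 1) Leaf @ [right_vine r s])"

fun left_vine :: "nat \<Rightarrow> nat \<Rightarrow> otree" where
  "left_vine r 0 = Leaf"
| "left_vine r (Suc s) = Node (left_vine r s # replicate (r - 1) Leaf)"

end

theory Submission
  imports Defs
begin

text \<open>
  Both conditions on \<open>T\<close> are compared with a third one, local to each internal vertex:
  \<^emph>\<open>every child except the last has a number of internal vertices divisible by \<open>k\<close>\<close>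
  (\<open>balanced\<close> below).

  The leaf condition amounts to balancedness because each child of a vertex has a leftmost leaf,
  which has left weight 0 inside that child. Testing the divisibility at these leaves shows that
  \<open>k\<close> divides every sum of the sizes of an initial segment of the children, the last child never
  being included; taking differences gives the sizes themselves
  (\<open>left_weights_dvd_iff_balanced\<close>).

  Vines are balanced, and grafting \<open>k\<close> internal vertices onto a leaf changes no subtree size modulo
  \<open>k\<close>, so everything grown from a vine is balanced. Conversely, in a balanced tree all children but
  the last have size 0 modulo \<open>k\<close> and so grow, by induction, from a leaf, while the last child grows
  from a vine of some length \<open>m < k\<close>. Since a vertex with leaves and one final vine of length \<open>m\<close> is
  the vine of length \<open>m + 1\<close>, the whole tree grows from that vine; if \<open>m + 1 = k\<close>, then the residue
  is 0 and one more step, from a leaf to the vine of length \<open>k\<close>, is put in front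
  (\<open>balanced_grows_from_vine\<close>).

  For \<open>k = 0\<close> divisibility by \<open>k\<close> means vanishing, so the same characterisation of the leaf
  condition says that a tree whose left weights vanish has only leaves as non-final children: it
  is a vine. The statements about right weights follow by reflecting trees.
\<close>

section \<open>Left weights and sizes of non-final children\<close>

fun balanced :: "nat \<Rightarrow> otree \<Rightarrow> bool" where
  "balanced k Leaf \<longleftrightarrow> True"
| "balanced k (Node ts) \<longleftrightarrow>
     (\<forall>t\<in>set ts. balanced k t) \<and> (\<forall>t\<in>set (butlast ts). k dvd num_internal t)"

lemma is_leaf_Leaf_iff: "is_leaf Leaf p \<longleftrightarrow> p = []"
  by (auto intro: is_leaf.intros elim: is_leaf.cases)

lemma is_leaf_Node_iff:
  "is_leaf (Node ts) p \<longleftrightarrow> (\<exists>j q. p = j # q \<and> j < length ts \<and> is_leaf (ts ! j) q)"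
  by (auto intro: is_leaf.intros elim: is_leaf.cases)

lemma all_leaves_Node_iff:
  "(\<forall>p. is_leaf (Node ts) p \<longrightarrow> P p)
    \<longleftrightarrow> (\<forall>j<length ts. \<forall>q. is_leaf (ts ! j) q \<longrightarrow> P (j # q))"
  by (auto simp: is_leaf_Node_iff)

lemma leftmost_leaf:
  assumes "full_tree r t" "r \<ge> 1"
  shows "\<exists>p. is_leaf t p \<and> left_weight t p = 0"
  using assms(1)
proof induction
  case full_Leaf
  show ?case by (auto simp: is_leaf_Leaf_iff)
next
  case (full_Node ts)
  then have "0 < length ts" using assms(2) by simp
  moreover from this full_Node.IH[of "ts ! 0"]
  obtain p where "is_leaf (ts ! 0) p" "left_weight (ts ! 0) p = 0" by auto
  ultimately show ?case
    by (intro exI[of _ "0 # p"]) (auto simp: is_leaf_Node_iff)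
qed

lemma dvd_prefix_sums_iff:
  fixes xs :: "nat list"
  shows "(\<forall>j\<le>length xs. k dvd sum_list (take j xs)) \<longleftrightarrow> (\<forall>x\<in>set xs. k dvd x)"
proof (induction xs)
  case (Cons x xs)
  have "(\<forall>j\<le>length (x # xs). k dvd sum_list (take j (x # xs)))
      \<longleftrightarrow> (\<forall>j\<le>length xs. k dvd x + sum_list (take j xs))"
    by (simp flip: less_Suc_eq_le add: All_less_Suc2)
  also have "\<dots> \<longleftrightarrow> k dvd x \<and> (\<forall>j\<le>length xs. k dvd sum_list (take j xs))"
  proof -
    have "k dvd x" if "\<forall>j\<le>length xs. k dvd x + sum_list (take j xs)"
      using that[rule_format, of 0] by simp
    then show ?thesis by (meson dvd_add dvd_add_right_iff)
  qed
  finally show ?case using Cons.IH by simp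
qed simp

lemma left_weights_dvd_iff_balanced:
  assumes "full_tree r t" "r \<ge> 1"
  shows "(\<forall>p. is_leaf t p \<longrightarrow> k dvd left_weight t p) \<longleftrightarrow> balanced k t"
  using assms(1)
proof induction
  case full_Leaf
  show ?case by (simp add: is_leaf_Leaf_iff)
next
  case (full_Node ts)
  let ?S = "\<lambda>j. \<Sum>t\<leftarrow>take j ts. num_internal t"
  have ne: "ts \<noteq> []" using full_Node.hyps assms(2) by auto
  have child: "(\<forall>p. is_leaf (ts ! j) p \<longrightarrow> k dvd ?S j + left_weight (ts ! j) p)
      \<longleftrightarrow> k dvd ?S j \<and> balanced k (ts ! j)" if "j < length ts" for j
  proof -
    have mem: "ts ! j \<in> set ts" using that by simp
    obtain p where "is_leaf (ts ! j) p" "left_weight (ts ! j) p = 0"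
      using leftmost_leaf full_Node.hyps(2)[OF mem] assms(2) by blast
    then have "k dvd ?S j" if "\<forall>p. is_leaf (ts ! j) p \<longrightarrow> k dvd ?S j + left_weight (ts ! j) p"
      using that by force
    then show ?thesis using full_Node.IH[OF mem] by (metis dvd_add_right_iff)
  qed
  have "(\<forall>p. is_leaf (Node ts) p \<longrightarrow> k dvd left_weight (Node ts) p)
      \<longleftrightarrow> (\<forall>j<length ts. \<forall>p. is_leaf (ts ! j) p \<longrightarrow> k dvd ?S j + left_weight (ts ! j) p)"
    by (simp add: all_leaves_Node_iff)
  also have "\<dots> \<longleftrightarrow> (\<forall>j<length ts. k dvd ?S j) \<and> (\<forall>t\<in>set ts. balanced k t)"
    using child by (auto simp: all_set_conv_all_nth)
  also have "(\<forall>j<length ts. k dvd ?S j)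
      \<longleftrightarrow> (\<forall>j\<le>length (butlast ts). k dvd sum_list (take j (map num_internal (butlast ts))))"
  proof -
    have "j < length ts \<longleftrightarrow> j \<le> length (butlast ts)" for j
      using ne by (cases ts) auto
    then show ?thesis by (auto simp: take_map take_butlast)
  qed
  also have "\<dots> \<longleftrightarrow> (\<forall>t\<in>set (butlast ts). k dvd num_internal t)"
    using dvd_prefix_sums_iff[of "map num_internal (butlast ts)" k] by simp
  finally show ?case by auto
qed

section \<open>Grafting preserves balancedness\<close>

lemma num_internal_right_vine [simp]: "num_internal (right_vine r s) = s"
  by (induction s) (auto simp: sum_list_replicate)

lemma balanced_right_vine: "balanced k (right_vine r s)"
  by (induction s) auto

lemma num_internal_replace_at:
  assumes "is_leaf t p"
  shows "num_internal (replace_at t p u) = num_internal t + num_internal u"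
  using assms
proof induction
  case (leaf_below j ts p)
  have "num_internal (ts ! j) \<le> sum_list (map num_internal ts)"
    using leaf_below.hyps(1) by (intro member_le_sum_list) auto
  then show ?case
    using leaf_below by (simp add: map_update sum_list_update)
qed simp

lemma balanced_replace_at:
  assumes "is_leaf t p" "balanced k t" "balanced k u" "k dvd num_internal u"
  shows "balanced k (replace_at t p u)"
  using assms(1,2)
proof induction
  case leaf_here
  show ?case using assms(3) by simp
next
  case (leaf_below j ts p)
  let ?t' = "replace_at (ts ! j) p u"
  have "balanced k ?t'" using leaf_below by simp
  then have "\<forall>t\<in>set (ts[j := ?t']). balanced k t"
    using leaf_below.prems set_update_subset_insert[of ts j ?t'] by auto
  moreover have "k dvd num_internal t" if t: "t \<in> set (butlast (ts[j := ?t']))" for t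
  proof (cases "j = length ts - 1")
    case True
    then show ?thesis using t leaf_below.prems by (simp add: butlast_list_update)
  next
    case False
    then have j: "j < length (butlast ts)" using leaf_below.hyps(1) by simp
    then have "ts ! j \<in> set (butlast ts)" by (metis nth_butlast nth_mem)
    then have "k dvd num_internal ?t'"
      using leaf_below.prems assms(4) num_internal_replace_at[OF leaf_below.hyps(2)] by simp
    moreover have "t \<in> insert ?t' (set (butlast ts))"
      using t False set_update_subset_insert[of "butlast ts" j ?t']
      by (auto simp: butlast_list_update)
    ultimately show ?thesis using leaf_below.prems by auto
  qed
  ultimately show ?case by simp
qed

lemma grown_from_vine_balanced:
  assumes "(expand_leaf (right_vine r k))\<^sup>*\<^sup>* (right_vine r s) t"
  shows "balanced k t"
  using assms
  by induction (auto simp: expand_leaf_def balanced_right_vine intro: balanced_replace_at)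

section \<open>Growing a balanced tree from a vine\<close>

lemma expand_leaf_child:
  assumes "expand_leaf u t t'"
  shows "expand_leaf u (Node (xs @ t # ys)) (Node (xs @ t' # ys))"
proof -
  obtain p where "is_leaf t p" "t' = replace_at t p u"
    using assms by (auto simp: expand_leaf_def)
  then show ?thesis
    by (auto simp: expand_leaf_def is_leaf_Node_iff intro!: exI[of _ "length xs # p"])
qed

lemma expand_leaf_steps_child:
  assumes "(expand_leaf u)\<^sup>*\<^sup>* t t'"
  shows "(expand_leaf u)\<^sup>*\<^sup>* (Node (xs @ t # ys)) (Node (xs @ t' # ys))"
  using assms
  by induction (auto intro: expand_leaf_child rtranclp.rtrancl_into_rtrancl)

text \<open>Growth in different children is independent, so it can be carried out from left to right;
  \<open>xs\<close> holds the children that are already finished.\<close>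

lemma expand_leaf_steps_children:
  assumes "list_all2 (expand_leaf u)\<^sup>*\<^sup>* ts ts'"
  shows "(expand_leaf u)\<^sup>*\<^sup>* (Node (xs @ ts)) (Node (xs @ ts'))"
  using assms
proof (induction arbitrary: xs rule: list_all2_induct)
  case (Cons t ts t' ts')
  have "(expand_leaf u)\<^sup>*\<^sup>* (Node (xs @ t # ts)) (Node (xs @ t' # ts))"
    using Cons.hyps(1) by (rule expand_leaf_steps_child)
  also have "(expand_leaf u)\<^sup>*\<^sup>* \<dots> (Node (xs @ t' # ts'))"
    using Cons.IH[of "xs @ [t']"] by simp
  finally show ?case .
qed simp

lemma balanced_grows_from_vine:
  assumes "full_tree r t" "r \<ge> 1" "k \<ge> 1" "balanced k t"
  shows "(expand_leaf (right_vine r k))\<^sup>*\<^sup>* (right_vine r (num_internal t mod k)) t"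
  using assms(1,4)
proof induction
  case full_Leaf
  show ?case by simp
next
  case (full_Node ts)
  let ?E = "(expand_leaf (right_vine r k))\<^sup>*\<^sup>*"
  define m where "m = num_internal (last ts) mod k"
  have ne: "ts \<noteq> []" using full_Node.hyps assms(2) by auto
  have ts: "ts = butlast ts @ [last ts]" using ne by simp
  have steps: "?E (right_vine r (num_internal t mod k)) t" if "t \<in> set ts" for t
    using full_Node that by auto
  have "?E Leaf t" if "t \<in> set (butlast ts)" for t
    using that steps[of t] full_Node.prems in_set_butlastD[of t ts]
    by (auto simp: dvd_eq_mod_eq_0)
  then have "list_all2 ?E (replicate (r - 1) Leaf) (butlast ts)"
    using full_Node.hyps(1) by (auto simp: list_all2_conv_all_nth)
  moreover have "?E (right_vine r m) (last ts)" using steps ne by (simp add: m_def)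
  ultimately have "list_all2 ?E (replicate (r - 1) Leaf @ [right_vine r m]) (butlast ts @ [last ts])"
    by (intro list_all2_appendI) auto
  from expand_leaf_steps_children[OF this, of "[]"] ts
  have grow: "?E (right_vine r (Suc m)) (Node ts)" by simp
  have "k dvd sum_list (map num_internal (butlast ts))"
    using full_Node.prems dvd_prefix_sums_iff[of "map num_internal (butlast ts)" k]
    by (metis balanced.simps(2) imageE list.set_map order_refl take_all)
  moreover have "num_internal (Node ts)
      = sum_list (map num_internal (butlast ts)) + Suc (num_internal (last ts))"
    by (subst ts) (simp del: append_butlast_last_id)
  ultimately have res: "num_internal (Node ts) mod k = Suc m mod k"
    by (auto simp: m_def mod_Suc_eq)
  show ?case
  proof (cases "Suc m = k")
    case True
    \<comment> \<open>The residue wraps around to 0: the vine of length \<open>k\<close> itself has to be grown from a leaf.\<close>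
    have "expand_leaf (right_vine r k) Leaf (right_vine r k)"
      unfolding expand_leaf_def by (intro exI[of _ "[]"]) (simp add: is_leaf_Leaf_iff)
    with grow True have "?E Leaf (Node ts)" by (auto intro: converse_rtranclp_into_rtranclp)
    then show ?thesis using res True by simp
  next
    case False
    have "m < k" using assms(3) by (simp add: m_def)
    with False grow res show ?thesis by simp
  qed
qed

lemma left_weights_dvd_iff_grown:
  assumes "full_tree r t" "r \<ge> 1" "k \<ge> 1"
  shows "(\<forall>p. is_leaf t p \<longrightarrow> k dvd left_weight t p)
    \<longleftrightarrow> (expand_leaf (right_vine r k))\<^sup>*\<^sup>* (right_vine r (num_internal t mod k)) t"
  unfolding left_weights_dvd_iff_balanced[OF assms(1,2)]
  using balanced_grows_from_vine[OF assms] grown_from_vine_balanced by (rule iffI)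

lemma num_internal_eq_0_iff: "num_internal t = 0 \<longleftrightarrow> t = Leaf"
  by (cases t) auto

lemma balanced_0_is_vine:
  assumes "full_tree r t" "r \<ge> 1" "balanced 0 t"
  shows "t = right_vine r (num_internal t)"
  using assms(1,3)
proof induction
  case (full_Node ts)
  have ne: "ts \<noteq> []" using full_Node.hyps assms(2) by auto
  have "butlast ts = replicate (r - 1) Leaf"
    using full_Node.hyps(1) full_Node.prems
    by (intro replicate_eqI) (auto simp: num_internal_eq_0_iff)
  then have ts: "ts = replicate (r - 1) Leaf @ [last ts]"
    using ne by (metis append_butlast_last_id)
  have "last ts = right_vine r (num_internal (last ts))"
    by (rule full_Node.IH) (use full_Node.prems ne in auto)
  moreover have "num_internal (Node ts) = Suc (num_internal (last ts))"
    by (subst ts) (simp add: sum_list_replicate)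
  ultimately show ?case using ts by (metis right_vine.simps(2))
qed simp

lemma left_weights_0_is_vine:
  assumes "full_tree r t" "r \<ge> 1" "\<forall>p. is_leaf t p \<longrightarrow> left_weight t p = 0"
  shows "t = right_vine r (num_internal t)"
proof (rule balanced_0_is_vine[OF assms(1,2)])
  show "balanced 0 t"
    using left_weights_dvd_iff_balanced[OF assms(1,2), of 0] assms(3) by simp
qed

section \<open>Reflection\<close>

fun mirror :: "otree \<Rightarrow> otree" where
  "mirror Leaf = Leaf"
| "mirror (Node ts) = Node (rev (map mirror ts))"

lemma mirror_mirror [simp]: "mirror (mirror t) = t"
  by (induction t rule: mirror.induct) (auto simp: rev_map map_idI)

lemma num_internal_mirror [simp]: "num_internal (mirror t) = num_internal t"
  by (induction t rule: mirror.induct)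
    (auto simp: sum_list_rev comp_def cong: map_cong simp flip: rev_map)

lemma full_tree_mirror: "full_tree r t \<Longrightarrow> full_tree r (mirror t)"
  by (induction rule: full_tree.induct) (auto intro!: full_tree.intros)

lemma mirror_left_vine [simp]: "mirror (left_vine r s) = right_vine r s"
  by (induction s) auto

lemma mirror_right_vine [simp]: "mirror (right_vine r s) = left_vine r s"
  by (metis mirror_left_vine mirror_mirror)

text \<open>Reflection carries leaves to leaves, exchanging the two weights and commuting with grafting.
  The existential form spares an explicit reflection of paths, which would depend on the
  number of children of each vertex passed.\<close>

lemma mirror_leaf:
  assumes "is_leaf t p"
  shows "\<exists>q. is_leaf (mirror t) q
    \<and> left_weight (mirror t) q = right_weight t p
    \<and> right_weight (mirror t) q = left_weight t p
    \<and> (\<forall>u. replace_at (mirror t) q (mirror u) = mirror (replace_at t p u))"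
  using assms
proof induction
  case leaf_here
  show ?case by (intro exI[of _ "[]"]) (simp add: is_leaf_Leaf_iff)
next
  case (leaf_below j ts p)
  then obtain q where q: "is_leaf (mirror (ts ! j)) q"
    "left_weight (mirror (ts ! j)) q = right_weight (ts ! j) p"
    "right_weight (mirror (ts ! j)) q = left_weight (ts ! j) p"
    "\<And>u. replace_at (mirror (ts ! j)) q (mirror u) = mirror (replace_at (ts ! j) p u)"
    by auto
  let ?ms = "rev (map mirror ts)" and ?i = "length ts - Suc j"
  \<comment> \<open>Child \<open>j\<close> becomes child \<open>?i\<close>, and the siblings before it become those after it.\<close>
  have nth: "?ms ! ?i = mirror (ts ! j)" "?i < length ?ms"
    using leaf_below.hyps(1) by (simp_all add: rev_nth)
  have sizes: "(\<Sum>t\<leftarrow>rev (map mirror us). num_internal t) = (\<Sum>t\<leftarrow>us. num_internal t)" for us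
    by (simp add: sum_list_rev comp_def flip: rev_map)
  have left: "take ?i ?ms = rev (map mirror (drop (Suc j) ts))"
    using leaf_below.hyps(1) by (simp add: take_rev drop_map)
  have right: "drop (Suc ?i) ?ms = rev (map mirror (take j ts))"
    using leaf_below.hyps(1) by (simp add: drop_rev take_map Suc_diff_Suc)
  have "?ms[?i := mirror t] = rev (map mirror (ts[j := t]))" for t
    using leaf_below.hyps(1) by (simp add: map_update rev_update)
  then show ?case
    using q nth sizes left right
    by (intro exI[of _ "?i # q"]) (auto simp: is_leaf_Node_iff)
qed

lemma right_weights_mirror:
  "(\<forall>p. is_leaf t p \<longrightarrow> P (right_weight t p))
    \<longleftrightarrow> (\<forall>p. is_leaf (mirror t) p \<longrightarrow> P (left_weight (mirror t) p))"
  using mirror_leaf[of t] mirror_leaf[of "mirror t"] by (metis mirror_mirror)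

lemma expand_leaf_mirror:
  "expand_leaf u t t' \<Longrightarrow> expand_leaf (mirror u) (mirror t) (mirror t')"
  unfolding expand_leaf_def using mirror_leaf by metis

lemma expand_leaf_steps_mirror:
  assumes "(expand_leaf u)\<^sup>*\<^sup>* t t'"
  shows "(expand_leaf (mirror u))\<^sup>*\<^sup>* (mirror t) (mirror t')"
  using assms
  by induction (auto intro: expand_leaf_mirror rtranclp.rtrancl_into_rtrancl)

lemma grown_mirror_iff:
  "(expand_leaf (right_vine r k))\<^sup>*\<^sup>* (right_vine r s) (mirror t)
    \<longleftrightarrow> (expand_leaf (left_vine r k))\<^sup>*\<^sup>* (left_vine r s) t"
  using expand_leaf_steps_mirror[of "right_vine r k" "right_vine r s" "mirror t"]
    expand_leaf_steps_mirror[of "left_vine r k" "left_vine r s" t] by auto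

theorem proposition3p6:
  fixes r k s :: nat and T :: otree
  assumes "r \<ge> 2" and "k \<ge> 1"
    and "full_tree r T"
    and "s = num_internal T mod k"
  shows "((\<forall>i. is_leaf T i \<longrightarrow> k dvd left_weight T i)
            \<longleftrightarrow> (expand_leaf (right_vine r k))\<^sup>*\<^sup>* (right_vine r s) T)
       \<and> ((\<forall>i. is_leaf T i \<longrightarrow> left_weight T i = 0) \<longrightarrow> T = right_vine r (num_internal T))
       \<and> ((\<forall>i. is_leaf T i \<longrightarrow> k dvd right_weight T i)
            \<longleftrightarrow> (expand_leaf (left_vine r k))\<^sup>*\<^sup>* (left_vine r s) T)
       \<and> ((\<forall>i. is_leaf T i \<longrightarrow> right_weight T i = 0) \<longrightarrow> T = left_vine r (num_internal T))"
proof (intro conjI impI)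
  have r: "r \<ge> 1" using assms(1) by simp
  note full' = full_tree_mirror[OF assms(3)]
  show "(\<forall>i. is_leaf T i \<longrightarrow> k dvd left_weight T i)
      \<longleftrightarrow> (expand_leaf (right_vine r k))\<^sup>*\<^sup>* (right_vine r s) T"
    using left_weights_dvd_iff_grown[OF assms(3) r assms(2)] assms(4) by simp
  show "T = right_vine r (num_internal T)" if "\<forall>i. is_leaf T i \<longrightarrow> left_weight T i = 0"
    using left_weights_0_is_vine[OF assms(3) r that] .
  show "(\<forall>i. is_leaf T i \<longrightarrow> k dvd right_weight T i)
      \<longleftrightarrow> (expand_leaf (left_vine r k))\<^sup>*\<^sup>* (left_vine r s) T"
    using left_weights_dvd_iff_grown[OF full' r assms(2)] assms(4)
      right_weights_mirror[of T "\<lambda>w. k dvd w"] grown_mirror_iff[of r k s T] by simp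
  show "T = left_vine r (num_internal T)" if "\<forall>i. is_leaf T i \<longrightarrow> right_weight T i = 0"
  proof -
    have "mirror T = right_vine r (num_internal T)"
      using left_weights_0_is_vine[OF full' r] that right_weights_mirror[of T "\<lambda>w. w = 0"] by simp
    then show ?thesis by (metis mirror_mirror mirror_right_vine)
  qed
qed

end
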